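(* Let $X$ be a stationary renewal point process on $\mathbb{R}$ that is a finitary factor of a Poisson point process on $\mathbb{R}$. Then the jump distribution of $X$ has exponential tails and a non-singular convolution power.
   Context: Point processes. Let $\mathbb{M}$ be the space of locally finite simple point measures on $\mathbb{R}$, identified with locally finite subsets of $\mathbb{R}$; translations act by $\theta_t(\{p_i\}_i)=\{p_i-t\}_i$, $t\in\mathbb{R}$. A point process is a random element of $\mathbb{M}$; it is stationary if its law is invariant under all $\theta_t$. A Poisson point process is always homogeneous, i.e. has a constant intensity $\lambda\in(0,\infty)$. Renewal point processes. Index the points of a point process as $\cdots<p_{-1}<p_0\le 0<p_1<p_2<\cdots$. It is a renewal point process if $\{p_{i+1}-p_i\}_{i\ge 1}$ are i.i.d.; their common law (a law on $(0,\infty)$) is the jump distribution. A jump distribution $T$ has exponential tails if there are $C,c>0$ with $\mathbb{P}(T\ge t)\le Ce^{-ct}$ for all $t\ge 0$. A jump distribution is non-singular if it has a non-zero absolutely continuous component (with respect to Lebesgue measure). The $k$-th convolution power of $T$ is the law of a sum of $k$ independent copies of $T$; $T$ has a non-singular convolution power if its $k$-th convolution power is non-singular for some integer $k\ge 1$. Finitary factor. For stationary point processes $\Lambda,X$, a factor from $\Lambda$ to $X$ is a measurable map $\varphi:\mathbb{M}\to\mathbb{M}$ such that $\varphi(\Lambda)$ and $X$ are equal in distribution and, on a set of full measure, $\varphi\circ\theta_t=\theta_t\circ\varphi$ for all $t\in\mathbb{R}$. A coding window for $\varphi$ is a measurable $w:\mathbb{M}\to\mathbb{N}\cup\{\infty\}$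 such that $\varphi(\mu)$ and $\varphi(\mu')$ agree on $[-1,1]$ whenever $\mu$ and $\mu'$ agree on $[-w(\mu),w(\mu)]$ (two measures agree on an interval if their restrictions to it coincide). $\varphi$ is finitary if it has a coding window $w$ with $w(\Lambda)<\infty$ almost surely; $X$ is then a finitary factor of $\Lambda$. *)

theory Defs
  imports "HOL-Probability.Probability"
begin

definition locally_finite_set :: "real set \<Rightarrow> bool" where
  "locally_finite_set S \<longleftrightarrow> (\<forall>a b. finite (S \<inter> {a..b}))"

text \<open>Locally finite simple point measures are represented by their supports. The
  sigma-algebra is the usual one, generated by the counts of points in bounded Borel sets.\<close>

definition point_configs :: "real set measure" where
  "point_configs = sigma {S. locally_finite_set S}
     {{S. locally_finite_set S \<and> card (S \<inter> B) = n} | B n. B \<in> sets borel \<and> bounded B}"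

definition translate :: "real \<Rightarrow> real set \<Rightarrow> real set" where
  "translate t S = (\<lambda>x. x - t) ` S"

definition point_process :: "'a measure \<Rightarrow> ('a \<Rightarrow> real set) \<Rightarrow> bool" where
  "point_process M X \<longleftrightarrow> prob_space M \<and> X \<in> M \<rightarrow>\<^sub>M point_configs"

definition law :: "'a measure \<Rightarrow> ('a \<Rightarrow> real set) \<Rightarrow> real set measure" where
  "law M X = distr M point_configs X"

definition stationary :: "'a measure \<Rightarrow> ('a \<Rightarrow> real set) \<Rightarrow> bool" where
  "stationary M X \<longleftrightarrow> (\<forall>t. law M (\<lambda>\<omega>. translate t (X \<omega>)) = law M X)"

text \<open>Writing the probabilities out, rather than using the library's Poisson distribution,
  also covers Borel sets of measure zero.\<close>

definition poisson_process :: "real \<Rightarrow> 'a measure \<Rightarrow> ('a \<Rightarrow> real set) \<Rightarrow> bool" where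
  "poisson_process r M X \<longleftrightarrow> r > 0 \<and> point_process M X \<and>
     (\<forall>B n. B \<in> sets borel \<and> bounded B \<longrightarrow>
        measure M {\<omega> \<in> space M. card (X \<omega> \<inter> B) = n} =
          (r * measure lborel B) ^ n / fact n * exp (- (r * measure lborel B))) \<and>
     (\<forall>(I :: nat set) B. finite I \<and> disjoint_family_on B I \<and>
          (\<forall>i\<in>I. B i \<in> sets borel \<and> bounded (B i)) \<longrightarrow>
        prob_space.indep_vars M (\<lambda>_. count_space UNIV) (\<lambda>i \<omega>. card (X \<omega> \<inter> B i)) I)"

definition indexes_points :: "(int \<Rightarrow> real) \<Rightarrow> real set \<Rightarrow> bool" where
  "indexes_points p S \<longleftrightarrow> strict_mono p \<and> range p = S \<and> p 0 \<le> 0 \<and> 0 < p 1"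

text \<open>The indexing is unique when it exists. Configurations that are bounded on one side have
  none, and all share one arbitrary value; a renewal process takes such values with probability zero.\<close>

definition nth_point :: "real set \<Rightarrow> int \<Rightarrow> real" where
  "nth_point S = (THE p. indexes_points p S)"

definition gap :: "int \<Rightarrow> real set \<Rightarrow> real" where
  "gap i S = nth_point S (i + 1) - nth_point S i"

definition renewal_process :: "'a measure \<Rightarrow> ('a \<Rightarrow> real set) \<Rightarrow> bool" where
  "renewal_process M X \<longleftrightarrow> point_process M X \<and>
     (AE \<omega> in M. \<exists>p. indexes_points p (X \<omega>)) \<and>
     prob_space.indep_vars M (\<lambda>_. borel) (\<lambda>i \<omega>. gap i (X \<omega>)) {1..} \<and>
     (\<forall>i\<ge>1. distr M borel (\<lambda>\<omega>. gap i (X \<omega>)) = distr M borel (\<lambda>\<omega>. gap 1 (X \<omega>)))"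

definition jump_distribution :: "'a measure \<Rightarrow> ('a \<Rightarrow> real set) \<Rightarrow> real measure" where
  "jump_distribution M X = distr M borel (\<lambda>\<omega>. gap 1 (X \<omega>))"

definition exponential_tails :: "real measure \<Rightarrow> bool" where
  "exponential_tails T \<longleftrightarrow> (\<exists>C>0. \<exists>c>0. \<forall>t\<ge>0. measure T {t..} \<le> C * exp (- c * t))"

definition lebesgue_decomposition ::
    "real measure \<Rightarrow> real measure \<Rightarrow> real measure \<Rightarrow> bool" where
  "lebesgue_decomposition T Tac Ts \<longleftrightarrow>
     sets Tac = sets borel \<and> sets Ts = sets borel \<and>
     (\<forall>A\<in>sets borel. emeasure T A = emeasure Tac A + emeasure Ts A) \<and>
     absolutely_continuous lborel Tac \<and>
     (\<exists>N\<in>null_sets lborel. emeasure Ts (UNIV - N) = 0)"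

definition nonsingular :: "real measure \<Rightarrow> bool" where
  "nonsingular T \<longleftrightarrow>
     (\<exists>Tac Ts. lebesgue_decomposition T Tac Ts \<and> emeasure Tac UNIV \<noteq> 0)"

definition convolution_power :: "nat \<Rightarrow> real measure \<Rightarrow> real measure" where
  "convolution_power k T = distr (\<Pi>\<^sub>M i\<in>{..<k}. T) borel (\<lambda>x. \<Sum>i<k. x i)"

definition is_factor ::
    "'a measure \<Rightarrow> ('a \<Rightarrow> real set) \<Rightarrow> 'b measure \<Rightarrow> ('b \<Rightarrow> real set) \<Rightarrow>
      (real set \<Rightarrow> real set) \<Rightarrow> bool" where
  "is_factor N Y M X \<phi> \<longleftrightarrow>
     \<phi> \<in> point_configs \<rightarrow>\<^sub>M point_configs \<and>
     law N (\<lambda>\<omega>. \<phi> (Y \<omega>)) = law M X \<and>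
     (AE \<mu> in law N Y. \<forall>t. \<phi> (translate t \<mu>) = translate t (\<phi> \<mu>))"

definition agree_on :: "real set \<Rightarrow> real set \<Rightarrow> real set \<Rightarrow> bool" where
  "agree_on J \<mu> \<mu>' \<longleftrightarrow> \<mu> \<inter> J = \<mu>' \<inter> J"

definition window_interval :: "enat \<Rightarrow> real set" where
  "window_interval n = (case n of enat k \<Rightarrow> {- real k..real k} | \<infinity> \<Rightarrow> UNIV)"

definition coding_window :: "(real set \<Rightarrow> real set) \<Rightarrow> (real set \<Rightarrow> enat) \<Rightarrow> bool" where
  "coding_window \<phi> w \<longleftrightarrow>
     w \<in> point_configs \<rightarrow>\<^sub>M count_space UNIV \<and>
     (\<forall>\<mu>\<in>space point_configs. \<forall>\<mu>'\<in>space point_configs.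
        agree_on (window_interval (w \<mu>)) \<mu> \<mu>' \<longrightarrow> agree_on {-1..1} (\<phi> \<mu>) (\<phi> \<mu>'))"

definition finitary_factor ::
    "'a measure \<Rightarrow> ('a \<Rightarrow> real set) \<Rightarrow> 'b measure \<Rightarrow> ('b \<Rightarrow> real set) \<Rightarrow> bool" where
  "finitary_factor N Y M X \<longleftrightarrow>
     (\<exists>\<phi> w. is_factor N Y M X \<phi> \<and> coding_window \<phi> w \<and> (AE \<omega> in N. w (Y \<omega>) < \<infinity>))"

end

theory Submission
  imports Defs
begin

text \<open>
  By Fubini one can freeze the Poisson configuration outside a large interval and obtain an event
  \<open>F\<close> of positive probability that depends only on the points in \<open>[-n, n]\<close> and on which the
  factor has a point in \<open>[-1, 1]\<close> that also depends only on the points in \<open>[-n, n]\<close>.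
  Far apart translates of \<open>F\<close> are independent, so the probability that \<open>X\<close> avoids an interval
  decays exponentially in its length, and a large gap \<open>p\<^sub>2 - p\<^sub>1\<close> forces one of two long
  deterministic intervals to be avoided.

  If all convolution powers were singular, all differences of points of \<open>X\<close> would lie in a
  single Lebesgue null set \<open>N\<close>. On \<open>F\<close> and its translate by \<open>u\<close>, two such points differ
  by \<open>u + x' - x\<close> with \<open>x, x'\<close> independent and of a law not depending on \<open>u\<close>; averaging over
  \<open>u\<close> in an interval of length one makes this difference fall into \<open>N\<close> with probability zero.
\<close>

subsection \<open>The space of point configurations\<close>

definition void_event :: "real set \<Rightarrow> real set set" where
  "void_event B = {S. locally_finite_set S \<and> S \<inter> B = {}}"

definition voids :: "real set set set" where
  "voids = {void_event B | B. B \<in> sets borel \<and> bounded B}"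

lemma finite_Int_bounded:
  assumes "locally_finite_set S" "bounded B"
  shows "finite (S \<inter> B)"
proof -
  obtain a where "\<And>x. x \<in> B \<Longrightarrow> norm x \<le> a"
    using assms(2) by (auto simp: bounded_iff)
  then have "S \<inter> B \<subseteq> S \<inter> {-a..a}" by force
  moreover have "finite (S \<inter> {-a..a})" using assms(1) by (simp add: locally_finite_set_def)
  ultimately show ?thesis by (rule finite_subset)
qed

lemma locally_finite_subset: "locally_finite_set S \<Longrightarrow> T \<subseteq> S \<Longrightarrow> locally_finite_set T"
  unfolding locally_finite_set_def by (meson Int_mono finite_subset order_refl)

lemma locally_finite_Un:
  "locally_finite_set S \<Longrightarrow> locally_finite_set T \<Longrightarrow> locally_finite_set (S \<union> T)"
  by (auto simp: locally_finite_set_def Int_Un_distrib2)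

lemma mem_translate_iff: "x \<in> translate t S \<longleftrightarrow> x + t \<in> S"
  unfolding translate_def by (force intro: rev_image_eqI)

lemma locally_finite_translate:
  assumes "locally_finite_set S" shows "locally_finite_set (translate t S)"
  unfolding locally_finite_set_def
proof (intro allI)
  fix a b
  have "translate t S \<inter> {a..b} = (\<lambda>x. x - t) ` (S \<inter> {a+t..b+t})"
    by (auto simp: translate_def)
  then show "finite (translate t S \<inter> {a..b})"
    using assms by (simp add: locally_finite_set_def)
qed

lemma translate_0 [simp]: "translate 0 S = S"
  by (auto simp: mem_translate_iff)

lemma translate_Int_empty_iff: "translate t S \<inter> B = {} \<longleftrightarrow> S \<inter> translate (-t) B = {}"
proof -
  have "translate t S \<inter> B = translate t (S \<inter> translate (-t) B)"
    by (auto simp: mem_translate_iff)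
  then show ?thesis by (simp add: translate_def)
qed

lemma bounded_translate: "bounded B \<Longrightarrow> bounded (translate t B)"
  using bounded_translation[of B "-t"] by (simp add: translate_def)

lemma translate_eq_vimage: "translate t B = (\<lambda>x. x + t) -` B"
  by (auto simp: mem_translate_iff)

lemma borel_translate: assumes "B \<in> sets borel" shows "translate t B \<in> sets borel"
proof -
  have "(\<lambda>x. x + t) \<in> borel \<rightarrow>\<^sub>M borel" by simp
  from measurable_sets[OF this assms] show ?thesis by (simp add: translate_eq_vimage)
qed

lemma emeasure_lborel_translate:
  assumes "B \<in> sets borel" shows "emeasure lborel (translate t B) = emeasure lborel B"
proof -
  have "emeasure lborel B = emeasure (distr lborel borel ((+) t)) B"
    by (simp add: lborel_distr_plus)
  also have "\<dots> = emeasure lborel ((+) t -` B)" using assms by (subst emeasure_distr) auto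
  also have "(+) t -` B = translate t B" by (auto simp: mem_translate_iff add.commute)
  finally show ?thesis by simp
qed

lemma measure_lborel_translate:
  "B \<in> sets borel \<Longrightarrow> measure lborel (translate t B) = measure lborel B"
  by (simp add: measure_def emeasure_lborel_translate)

lemma space_point_configs: "space point_configs = {S. locally_finite_set S}"
  unfolding point_configs_def by (rule space_measure_of) auto

lemma sets_point_configs_counts: "sets point_configs = sigma_sets {S. locally_finite_set S}
     {{S. locally_finite_set S \<and> card (S \<inter> B) = n} | B n. B \<in> sets borel \<and> bounded B}"
  unfolding point_configs_def by (rule sets_measure_of) auto

lemma void_event_sets: 
  assumes "B \<in> sets borel" "bounded B" shows "void_event B \<in> sets point_configs"
proof -
  have "void_event B = {S. locally_finite_set S \<and> card (S \<inter> B) = 0}"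
    using finite_Int_bounded[OF _ assms(2)] by (auto simp: void_event_def)
  then show ?thesis unfolding sets_point_configs_counts using assms
    by (intro sigma_sets.Basic) blast
qed

lemma exists_separating_scale:
  assumes "finite (F :: real set)" shows "\<exists>m::nat. inj_on (\<lambda>x. \<lfloor>real m * x\<rfloor>) F"
proof -
  have "\<forall>z\<in>F \<times> F. \<forall>\<^sub>F m in sequentially. fst z < snd z \<longrightarrow> real m * fst z + 1 \<le> real m * snd z"
  proof
    fix z :: "real \<times> real"
    obtain x y where z: "z = (x, y)" by fastforce
    show "\<forall>\<^sub>F m in sequentially. fst z < snd z \<longrightarrow> real m * fst z + 1 \<le> real m * snd z"
    proof (cases "x < y")
      case True
      obtain m0 :: nat where "1 / (y - x) \<le> real m0" using real_arch_simple by blast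
      then have "real m * x + 1 \<le> real m * y" if "m \<ge> m0" for m
      proof -
        have "1 / (y - x) \<le> real m" using \<open>1 / (y - x) \<le> real m0\<close> that by linarith
        then show ?thesis using True by (simp add: field_simps)
      qed
      then show ?thesis unfolding eventually_sequentially z by auto
    qed (simp add: z)
  qed
  then have "\<forall>\<^sub>F m in sequentially. \<forall>z\<in>F \<times> F. fst z < snd z \<longrightarrow> real m * fst z + 1 \<le> real m * snd z"
    using assms by (simp add: eventually_ball_finite_distrib)
  then obtain m where m: "\<And>x y. x \<in> F \<Longrightarrow> y \<in> F \<Longrightarrow> x < y \<Longrightarrow> real m * x + 1 \<le> real m * y"
    unfolding eventually_sequentially by fastforce
  have "\<lfloor>real m * x\<rfloor> \<noteq> \<lfloor>real m * y\<rfloor>" if "x \<in> F" "y \<in> F" "x < y" for x y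
    using m[OF that] by linarith
  then have "inj_on (\<lambda>x. \<lfloor>real m * x\<rfloor>) F"
    by (intro inj_onI) (metis linorder_neqE)
  then show ?thesis ..
qed

text \<open>Counts are suprema over \<open>m\<close> of the number of cells of width \<open>1/m\<close> that are hit.\<close>

lemma sets_point_configs_voids: "sets point_configs = sigma_sets {S. locally_finite_set S} voids"
proof
  let ?Om = "{S. locally_finite_set S}"
  interpret sigma_algebra ?Om "sigma_sets ?Om voids"
    by (rule sigma_algebra_sigma_sets) (auto simp: voids_def void_event_def)
  have void: "{S \<in> ?Om. S \<inter> B = {}} \<in> sigma_sets ?Om voids" if "B \<in> sets borel" "bounded B" for B
  proof -
    have "{S \<in> ?Om. S \<inter> B = {}} = void_event B" by (auto simp: void_event_def)
    then show ?thesis using that by (auto simp: voids_def)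
  qed
  have count: "{S. locally_finite_set S \<and> card (S \<inter> B) = n} \<in> sigma_sets ?Om voids"
    if B: "B \<in> sets borel" "bounded B" for B n
  proof -
    obtain a where a: "\<And>x. x \<in> B \<Longrightarrow> \<bar>x\<bar> \<le> a" using B(2) by (auto simp: bounded_iff)
    define cell where "cell m k = B \<inter> {x. \<lfloor>real m * x\<rfloor> = k}" for m :: nat and k :: int
    have cell: "cell m k \<in> sets borel" "bounded (cell m k)" for m k
    proof -
      have "{x. \<lfloor>real m * x\<rfloor> = k} \<in> sets borel" by measurable
      then show "cell m k \<in> sets borel" using B by (simp add: cell_def)
      show "bounded (cell m k)" using B(2) by (auto simp: cell_def)
    qed
    define K where "K m = {\<lfloor>- real m * a\<rfloor>..\<lfloor>real m * a\<rfloor>}" for m :: nat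
    have hit: "(\<lambda>x. \<lfloor>real m * x\<rfloor>) ` (S \<inter> B) = {k \<in> K m. S \<inter> cell m k \<noteq> {}}" for m S
    proof -
      have "\<lfloor>real m * x\<rfloor> \<in> K m" if "x \<in> B" for x
      proof -
        have "real m * x \<le> real m * a" "- (real m * a) \<le> real m * x" using a[OF that]
          mult_left_mono[of x a "real m"] mult_left_mono[of "-a" x "real m"] by auto
        then show ?thesis unfolding K_def by (auto intro!: floor_mono)
      qed
      then show ?thesis by (auto simp: cell_def)
    qed
    have "{S \<in> ?Om. n \<le> card (S \<inter> B)} =
      {S \<in> ?Om. \<exists>m. \<exists>J\<in>{J. J \<subseteq> K m \<and> card J = n}. \<forall>k\<in>J. \<not> S \<inter> cell m k = {}}" (is "?l = ?r") for n
    proof safe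
      fix S assume S: "locally_finite_set S" "n \<le> card (S \<inter> B)"
      obtain m where m: "inj_on (\<lambda>x. \<lfloor>real m * x\<rfloor>) (S \<inter> B)"
        using exists_separating_scale finite_Int_bounded S(1) B(2) by blast
      have "n \<le> card {k \<in> K m. S \<inter> cell m k \<noteq> {}}"
        using S card_image[OF m] by (simp add: hit)
      then obtain J where "J \<subseteq> {k \<in> K m. S \<inter> cell m k \<noteq> {}}" "card J = n"
        by (meson obtain_subset_with_card_n)
      then show "\<exists>m. \<exists>J\<in>{J. J \<subseteq> K m \<and> card J = n}. \<forall>k\<in>J. \<not> S \<inter> cell m k = {}" by blast
    next
      fix S m J assume S: "locally_finite_set S" and J: "J \<subseteq> K m" "\<forall>k\<in>J. \<not> S \<inter> cell m k = {}"
      have "J \<subseteq> (\<lambda>x. \<lfloor>real m * x\<rfloor>) ` (S \<inter> B)" using J by (auto simp: hit)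
      then show "card J \<le> card (S \<inter> B)"
        by (meson finite_Int_bounded[OF S B(2)] surj_card_le)
    qed
    moreover have "{S \<in> ?Om. \<exists>m. \<exists>J\<in>{J. J \<subseteq> K m \<and> card J = n}. \<forall>k\<in>J. \<not> S \<inter> cell m k = {}}
       \<in> sigma_sets ?Om voids" for n
    proof -
      have [simp]: "finite (K m)" for m by (simp add: K_def)
      then have fJ: "J \<subseteq> K m \<Longrightarrow> finite J" for J m using finite_subset by blast
      have "{S \<in> ?Om. \<forall>k\<in>J. \<not> S \<inter> cell m k = {}} \<in> sigma_sets ?Om voids" 
        if "J \<subseteq> K m" for J m
        by (intro sets_Collect_finite_All sets_Collect_neg void cell fJ[OF that])
      then show ?thesis
        by (intro sets_Collect_countable_Ex sets_Collect_finite_Ex) auto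
    qed
    ultimately have ge: "{S \<in> ?Om. n \<le> card (S \<inter> B)} \<in> sigma_sets ?Om voids" for n
      by simp
    have "{S. locally_finite_set S \<and> card (S \<inter> B) = n} =
       {S \<in> ?Om. n \<le> card (S \<inter> B)} - {S \<in> ?Om. Suc n \<le> card (S \<inter> B)}" by auto
    then show ?thesis using Diff[OF ge[of n] ge[of "Suc n"]] by simp
  qed
  show "sets point_configs \<subseteq> sigma_sets ?Om voids"
    unfolding sets_point_configs_counts using count by (intro sigma_sets_mono) blast
  show "sigma_sets ?Om voids \<subseteq> sets point_configs"
    unfolding space_point_configs[symmetric]
    by (rule sets.sigma_sets_subset) (auto simp: voids_def void_event_sets)
qed

lemma measurable_point_configsI:
  assumes "\<And>x. x \<in> space M \<Longrightarrow> locally_finite_set (f x)"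
    and "\<And>B. B \<in> sets borel \<Longrightarrow> bounded B \<Longrightarrow> {x \<in> space M. f x \<inter> B = {}} \<in> sets M"
  shows "f \<in> M \<rightarrow>\<^sub>M point_configs"
proof -
  have "f -` Y \<inter> space M \<in> sets M" if Y: "Y \<in> voids" for Y
  proof -
    obtain B where B: "Y = void_event B" "B \<in> sets borel" "bounded B"
      using Y unfolding voids_def by blast
    have "f -` Y \<inter> space M = {x \<in> space M. f x \<inter> B = {}}"
      using assms(1) B(1) by (auto simp: void_event_def)
    then show ?thesis using assms(2) B by simp
  qed
  then have "f \<in> M \<rightarrow>\<^sub>M sigma {S. locally_finite_set S} voids"
    using assms(1) by (intro measurable_measure_of) (auto simp: voids_def void_event_def)
  moreover have "sets (sigma {S. locally_finite_set S} voids) = sets point_configs"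
    unfolding sets_point_configs_voids
    by (rule sets_measure_of) (auto simp: voids_def void_event_def)
  ultimately show ?thesis using measurable_cong_sets by blast
qed

lemma Int_empty_measurable:
  assumes "f \<in> M \<rightarrow>\<^sub>M point_configs" "B \<in> sets borel" "bounded B"
  shows "{x \<in> space M. f x \<inter> B = {}} \<in> sets M"
proof -
  have "{x \<in> space M. f x \<inter> B = {}} = f -` void_event B \<inter> space M"
    using measurable_space[OF assms(1)] by (auto simp: void_event_def space_point_configs)
  then show ?thesis using measurable_sets[OF assms(1) void_event_sets] assms by metis
qed

lemma locally_finite_space: "f \<in> M \<rightarrow>\<^sub>M point_configs \<Longrightarrow> x \<in> space M \<Longrightarrow> locally_finite_set (f x)"
  using measurable_space[of f M point_configs x] by (simp add: space_point_configs)

lemma measurable_translate [measurable (raw)]: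
  assumes "f \<in> M \<rightarrow>\<^sub>M point_configs" shows "(\<lambda>x. translate t (f x)) \<in> M \<rightarrow>\<^sub>M point_configs"
proof (rule measurable_point_configsI)
  show "locally_finite_set (translate t (f x))" if "x \<in> space M" for x
    by (rule locally_finite_translate[OF locally_finite_space[OF assms that]])
  show "{x \<in> space M. translate t (f x) \<inter> B = {}} \<in> sets M" if "B \<in> sets borel" "bounded B" for B
    unfolding translate_Int_empty_iff
    using that by (intro Int_empty_measurable[OF assms] borel_translate bounded_translate)
qed

definition splice_at :: "real set \<Rightarrow> real set \<Rightarrow> real set \<Rightarrow> real set" where
  "splice_at A a b = (a \<inter> A) \<union> (b - A)"

lemma measurable_splice_at [measurable (raw)]:
  assumes A: "A \<in> sets borel" and f: "f \<in> M \<rightarrow>\<^sub>M point_configs" and g: "g \<in> M \<rightarrow>\<^sub>M point_configs"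
  shows "(\<lambda>x. splice_at A (f x) (g x)) \<in> M \<rightarrow>\<^sub>M point_configs"
proof (rule measurable_point_configsI)
  show "locally_finite_set (splice_at A (f x) (g x))" if "x \<in> space M" for x
    using locally_finite_space[OF f that] locally_finite_space[OF g that] unfolding splice_at_def
    by (intro locally_finite_Un) (erule locally_finite_subset, blast)+
next
  fix B :: "real set" assume B: "B \<in> sets borel" "bounded B"
  have "{x \<in> space M. splice_at A (f x) (g x) \<inter> B = {}} =
      {x \<in> space M. f x \<inter> (A \<inter> B) = {}} \<inter> {x \<in> space M. g x \<inter> (B - A) = {}}"
    by (auto simp: splice_at_def)
  also have "\<dots> \<in> sets M"
    by (rule sets.Int[OF Int_empty_measurable[OF f] Int_empty_measurable[OF g]])
       (use A B in auto)
  finally show "{x \<in> space M. splice_at A (f x) (g x) \<inter> B = {}} \<in> sets M" .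
qed

subsection \<open>Independence in Poisson processes\<close>

locale poisson_law = prob_space P for P :: "real set measure" +
  fixes r :: real
  assumes sets_P: "sets P = sets point_configs"
    and prob_void: "\<And>B. B \<in> sets borel \<Longrightarrow> bounded B \<Longrightarrow>
      prob (void_event B) = exp (- (r * measure lborel B))"
begin

lemma space_P: "space P = {S. locally_finite_set S}"
  using sets_eq_imp_space_eq[OF sets_P] space_point_configs by simp

lemma measurable_P: "P \<rightarrow>\<^sub>M K = point_configs \<rightarrow>\<^sub>M K"
  by (rule measurable_cong_sets[OF sets_P refl])

lemma measurable_id_P [measurable]: "(\<lambda>x. x) \<in> P \<rightarrow>\<^sub>M point_configs"
  unfolding measurable_P by simp

lemma measurable_pair_P [measurable]:
  "fst \<in> P \<Otimes>\<^sub>M P \<rightarrow>\<^sub>M point_configs" "snd \<in> P \<Otimes>\<^sub>M P \<rightarrow>\<^sub>M point_configs"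
  using measurable_fst[of P P] measurable_snd[of P P]
  by (simp_all add: measurable_cong_sets[OF refl sets_P])

text \<open>Avoidance probabilities determine the law, and they factorise over disjoint sets.\<close>

lemma distr_splice:
  assumes A: "A \<in> sets borel"
  shows "distr (P \<Otimes>\<^sub>M P) point_configs (\<lambda>z. splice_at A (fst z) (translate (-u) (snd z))) = P"
    (is "distr _ _ ?f = P")
proof (rule measure_eqI_generator_eq[where E=voids and \<Omega>="{S. locally_finite_set S}" and A="\<lambda>_. void_event {}"])
  interpret PP: pair_prob_space P P ..
  have f: "?f \<in> P \<Otimes>\<^sub>M P \<rightarrow>\<^sub>M point_configs" using A by measurable
  interpret D: prob_space "distr (P \<Otimes>\<^sub>M P) point_configs ?f" by (rule PP.prob_space_distr[OF f])
  show "Int_stable voids"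
  proof (rule Int_stableI)
    fix Y Z assume "Y \<in> voids" "Z \<in> voids"
    then obtain B C where BC: "Y = void_event B" "B \<in> sets borel" "bounded B"
        "Z = void_event C" "C \<in> sets borel" "bounded C"
      unfolding voids_def by blast
    have "Y \<inter> Z = void_event (B \<union> C)" using BC by (auto simp: void_event_def)
    moreover have "B \<union> C \<in> sets borel" "bounded (B \<union> C)" using BC by auto
    ultimately show "Y \<inter> Z \<in> voids" unfolding voids_def by blast
  qed
  show "voids \<subseteq> Pow {S. locally_finite_set S}" by (auto simp: voids_def void_event_def)
  show "sets (distr (P \<Otimes>\<^sub>M P) point_configs ?f) = sigma_sets {S. locally_finite_set S} voids"
    "sets P = sigma_sets {S. locally_finite_set S} voids"
    by (simp_all add: sets_P sets_point_configs_voids)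
  show "range (\<lambda>_. void_event {}) \<subseteq> voids" by (auto simp: voids_def)
  show "(\<Union>i. void_event {}) = {S. locally_finite_set S}" by (auto simp: void_event_def)
  show "emeasure (distr (P \<Otimes>\<^sub>M P) point_configs ?f) (void_event {}) \<noteq> \<infinity>" by simp
  fix Y assume "Y \<in> voids"
  then obtain B where B: "Y = void_event B" "B \<in> sets borel" "bounded B"
    unfolding voids_def by blast
  define C where "C = translate u (B - A)"
  have C: "C \<in> sets borel" "bounded C"
    unfolding C_def using A B by (auto intro!: borel_translate bounded_translate)
  have BA: "B \<inter> A \<in> sets borel" "bounded (B \<inter> A)" using A B by auto
  have fin: "emeasure lborel (B \<inter> A) < \<infinity>" "emeasure lborel (B - A) < \<infinity>"
    using B emeasure_bounded_finite bounded_Int bounded_diff by blast+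
  have "?f -` Y \<inter> space (P \<Otimes>\<^sub>M P) = void_event (B \<inter> A) \<times> void_event C"
  proof -
    have "splice_at A a (translate (-u) b) \<inter> B = {} \<longleftrightarrow> a \<inter> (B \<inter> A) = {} \<and> b \<inter> C = {}" for a b
    proof -
      have "translate (-u) b \<inter> (B - A) = {} \<longleftrightarrow> b \<inter> C = {}"
        unfolding C_def translate_Int_empty_iff by simp
      then show ?thesis unfolding splice_at_def by blast
    qed
    moreover have "locally_finite_set (splice_at A a (translate (-u) b))"
      if "locally_finite_set a" "locally_finite_set b" for a b
      unfolding splice_at_def
      by (rule locally_finite_Un[OF locally_finite_subset[OF that(1)]
            locally_finite_subset[OF locally_finite_translate[OF that(2), of "-u"]]]) auto
    ultimately show ?thesis
      by (auto simp: B(1) void_event_def space_pair_measure space_P)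
  qed
  then have "emeasure (distr (P \<Otimes>\<^sub>M P) point_configs ?f) Y =
      emeasure (P \<Otimes>\<^sub>M P) (void_event (B \<inter> A) \<times> void_event C)"
    using B by (simp add: emeasure_distr[OF f] void_event_sets)
  also have "\<dots> = emeasure P (void_event (B \<inter> A)) * emeasure P (void_event C)"
    using BA C void_event_sets sets_P by (intro emeasure_pair_measure_Times) auto
  also have "\<dots> = ennreal (exp (- (r * measure lborel (B \<inter> A))) * exp (- (r * measure lborel C)))"
    using BA C by (simp add: emeasure_eq_measure prob_void ennreal_mult)
  also have "exp (- (r * measure lborel (B \<inter> A))) * exp (- (r * measure lborel C)) =
      exp (- (r * measure lborel B))"
  proof -
    have "measure lborel B = measure lborel (B \<inter> A) + measure lborel (B - A)"
      using measure_Union[of lborel "B \<inter> A" "B - A"] A B fin by (simp add: Int_Diff_Un Int_Diff_disjoint)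
    then show ?thesis unfolding C_def using A B 
      by (simp add: measure_lborel_translate exp_add[symmetric] algebra_simps)
  qed
  finally show "emeasure (distr (P \<Otimes>\<^sub>M P) point_configs ?f) Y = emeasure P Y"
    using B by (simp add: emeasure_eq_measure prob_void)
qed

end

definition determined_on :: "real set \<Rightarrow> real set set \<Rightarrow> bool" where
  "determined_on A F \<longleftrightarrow> (\<forall>c\<in>space point_configs. \<forall>c'\<in>space point_configs.
     c \<inter> A = c' \<inter> A \<longrightarrow> c \<in> F \<longrightarrow> c' \<in> F)"

lemma determined_onD:
  "determined_on A F \<Longrightarrow> locally_finite_set c \<Longrightarrow> locally_finite_set c' \<Longrightarrow> c \<inter> A = c' \<inter> A \<Longrightarrow>
    c \<in> F \<longleftrightarrow> c' \<in> F"
  unfolding determined_on_def space_point_configs Ball_def mem_Collect_eq by metis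

lemma splice_at_Int [simp]: "splice_at A a b \<inter> A = a \<inter> A"
  by (auto simp: splice_at_def)

lemma locally_finite_splice_at:
  "locally_finite_set a \<Longrightarrow> locally_finite_set b \<Longrightarrow> locally_finite_set (splice_at A a b)"
  unfolding splice_at_def by (intro locally_finite_Un) (erule locally_finite_subset, blast)+

lemma translate_splice_at_Int:
  assumes "u \<ge> 2 * n + 1" "v \<ge> 0"
  shows "translate (u + v) (splice_at {-n..n} a (translate (-u) b)) \<inter> {-n..n} =
    translate v b \<inter> {-n..n}"
  using assms by (auto simp: splice_at_def mem_translate_iff algebra_simps)

context poisson_law
begin

lemma measurable_splice:
  assumes "A \<in> sets borel"
  shows "(\<lambda>z. splice_at A (fst z) (translate (-u) (snd z))) \<in> P \<Otimes>\<^sub>M P \<rightarrow>\<^sub>M P"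
proof -
  have "(\<lambda>z. splice_at A (fst z) (translate (-u) (snd z))) \<in> P \<Otimes>\<^sub>M P \<rightarrow>\<^sub>M point_configs"
    using assms by (intro measurable_splice_at measurable_translate measurable_pair_P)
  then show ?thesis by (simp add: measurable_cong_sets[OF refl sets_P])
qed

lemma emeasure_splice:
  assumes A: "A \<in> sets borel" and G: "G \<in> sets P"
  shows "emeasure P G =
    emeasure (P \<Otimes>\<^sub>M P) {z \<in> space (P \<Otimes>\<^sub>M P). splice_at A (fst z) (translate (-u) (snd z)) \<in> G}"
proof -
  have "emeasure P G =
      emeasure (distr (P \<Otimes>\<^sub>M P) point_configs (\<lambda>z. splice_at A (fst z) (translate (-u) (snd z)))) G"
    by (simp add: distr_splice[OF A])
  also have "\<dots> = emeasure (P \<Otimes>\<^sub>M P)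
      ((\<lambda>z. splice_at A (fst z) (translate (-u) (snd z))) -` G \<inter> space (P \<Otimes>\<^sub>M P))"
    using measurable_splice[OF A, of u] G by (subst emeasure_distr) (auto simp: sets_P measurable_cong_sets[OF refl sets_P])
  finally show ?thesis by (simp add: vimage_def Int_def conj_commute)
qed

lemma obtains_local_event:
  assumes w: "coding_window \<phi> w" and fin: "AE c in P. w c < \<infinity>"
    and phi: "\<phi> \<in> point_configs \<rightarrow>\<^sub>M point_configs"
    and pos: "prob {c \<in> space P. \<phi> c \<inter> {-1..1} \<noteq> {}} > 0"
  obtains n :: nat and F where "F \<in> sets P" "prob F > 0" "determined_on {-real n..real n} F"
    "\<And>c. c \<in> F \<Longrightarrow> \<phi> c \<inter> {-1..1} \<noteq> {}"
    "\<And>c c'. c \<in> F \<Longrightarrow> locally_finite_set c' \<Longrightarrow> c \<inter> {-real n..real n} = c' \<inter> {-real n..real n} \<Longrightarrow>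
      \<phi> c \<inter> {-1..1} = \<phi> c' \<inter> {-1..1}"
proof -
  have wm: "w \<in> P \<rightarrow>\<^sub>M count_space UNIV" and
    win: "\<And>\<mu> \<mu>'. locally_finite_set \<mu> \<Longrightarrow> locally_finite_set \<mu>' \<Longrightarrow>
      agree_on (window_interval (w \<mu>)) \<mu> \<mu>' \<Longrightarrow> agree_on {-1..1} (\<phi> \<mu>) (\<phi> \<mu>')"
    using w by (auto simp: coding_window_def measurable_P space_point_configs)
  define H where "H = {c \<in> space P. \<phi> c \<inter> {-1..1} \<noteq> {}}"
  have "{c \<in> space P. \<phi> c \<inter> {-1..1} = {}} \<in> sets P"
    using phi by (intro Int_empty_measurable) (auto simp: measurable_P)
  then have H: "H \<in> sets P" unfolding H_def by (rule sets.sets_Collect_neg)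
  define E where "E n = {c \<in> space P. w c \<le> enat n} \<inter> H" for n
  have E: "E n \<in> sets P" for n
  proof -
    have "{c \<in> space P. w c \<le> enat n} = w -` {..enat n} \<inter> space P" by auto
    also have "\<dots> \<in> sets P" using measurable_sets[OF wm] by simp
    finally show ?thesis unfolding E_def using H by blast
  qed
  have "\<exists>n. emeasure P (E n) \<noteq> 0"
  proof (rule ccontr)
    assume "\<nexists>n. emeasure P (E n) \<noteq> 0"
    then have "AE c in P. \<forall>n. c \<notin> E n"
      unfolding AE_all_countable using E by (auto intro!: AE_not_in simp: null_sets_def)
    with fin have "AE c in P. c \<notin> H"
    proof eventually_elim
      case (elim c)
      then obtain k where "w c = enat k" by auto
      then show ?case using elim(2) by (auto simp: E_def H_def)
    qed
    then have "prob H = 0" using H by (simp add: AE_iff_null_sets[symmetric] null_setsD1 measure_def)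
    with pos show False by (simp add: H_def)
  qed
  then obtain n where n: "emeasure P (E n) \<noteq> 0" by blast
  define A where "A = {-real n..real n}"
  have A: "A \<in> sets borel" by (simp add: A_def)
  let ?f = "\<lambda>z. splice_at A (fst z) (translate (-0) (snd z))"
  interpret PP: pair_prob_space P P ..
  define W where "W = {z \<in> space (P \<Otimes>\<^sub>M P). ?f z \<in> E n}"
  have W: "W \<in> sets (P \<Otimes>\<^sub>M P)"
    using measurable_sets[OF measurable_splice[OF A, of 0] E] unfolding W_def
    by (simp add: vimage_def Int_def conj_commute)
  have "emeasure (P \<Otimes>\<^sub>M P) W \<noteq> 0" using n emeasure_splice[OF A E, of n 0] by (simp add: W_def)
  then have "(\<integral>\<^sup>+ y. emeasure P ((\<lambda>x. (x, y)) -` W) \<partial>P) \<noteq> 0"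
    using PP.emeasure_pair_measure_alt2[OF W] by simp
  have "\<exists>e\<in>space P. emeasure P ((\<lambda>x. (x, e)) -` W) \<noteq> 0"
  proof (rule ccontr)
    assume "\<not> ?thesis"
    then have "(\<integral>\<^sup>+ y. emeasure P ((\<lambda>x. (x, y)) -` W) \<partial>P) = (\<integral>\<^sup>+ y. 0 \<partial>P)"
      by (intro nn_integral_cong) auto
    with \<open>(\<integral>\<^sup>+ y. emeasure P ((\<lambda>x. (x, y)) -` W) \<partial>P) \<noteq> 0\<close> show False by simp
  qed
  then obtain e where e: "e \<in> space P" "emeasure P ((\<lambda>x. (x, e)) -` W) \<noteq> 0" by blast
  define F where "F = (\<lambda>x. (x, e)) -` W"
  have F: "F \<in> sets P" unfolding F_def using sets_Pair2[OF W] by simp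
  have F_iff: "c \<in> F \<longleftrightarrow> locally_finite_set c \<and> splice_at A c e \<in> E n" for c
    using e by (auto simp: F_def W_def space_pair_measure space_P)
  have eq: "\<phi> (splice_at A c e) \<inter> {-1..1} = \<phi> c \<inter> {-1..1}" if cF: "c \<in> F" for c
  proof -
    have "w (splice_at A c e) \<le> enat n" using cF by (simp add: F_iff E_def)
    then obtain k where k: "w (splice_at A c e) = enat k" "k \<le> n" by (cases "w (splice_at A c e)") auto
    have "window_interval (enat k) \<subseteq> A" using k by (auto simp: window_interval_def A_def)
    then have "agree_on (window_interval (enat k)) (splice_at A c e) c"
      by (auto simp: agree_on_def splice_at_def)
    then show ?thesis
      using win[of "splice_at A c e" c] cF e k
      by (auto simp: agree_on_def F_iff space_P intro: locally_finite_splice_at)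
  qed
  have cong: "splice_at A c e = splice_at A c' e" if "c \<inter> A = c' \<inter> A" for c c'
    using that by (simp add: splice_at_def)
  show ?thesis
  proof (rule that)
    show "F \<in> sets P" by (rule F)
    show "prob F > 0" using e(2) by (simp add: F_def emeasure_eq_measure zero_less_measure_iff)
    show "determined_on {-real n..real n} F"
      unfolding determined_on_def
    proof (intro ballI impI)
      fix c c' assume "c' \<in> space point_configs" "c \<in> F"
        and eqA: "c \<inter> {-real n..real n} = c' \<inter> {-real n..real n}"
      then show "c' \<in> F" using cong[OF eqA[folded A_def]] by (simp add: F_iff space_point_configs)
    qed
    show "\<phi> c \<inter> {-1..1} \<noteq> {}" if "c \<in> F" for c
      using eq[OF that] that by (auto simp: F_iff E_def H_def)
    show "\<phi> c \<inter> {-1..1} = \<phi> c' \<inter> {-1..1}"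
      if "c \<in> F" "locally_finite_set c'" "c \<inter> {-real n..real n} = c' \<inter> {-real n..real n}" for c c'
    proof -
      have "splice_at A c e = splice_at A c' e" using that(3) by (intro cong) (simp add: A_def)
      moreover from this have "c' \<in> F" using that by (simp add: F_iff)
      ultimately show ?thesis using eq that(1) by metis
    qed
  qed
qed

lemma measurable_translate_P: "translate t \<in> P \<rightarrow>\<^sub>M P"
  using measurable_translate[OF measurable_id_P] by (simp add: measurable_cong_sets[OF refl sets_P])

lemma prob_no_translate_in:
  assumes F: "F \<in> sets P" and loc: "determined_on {-n..n} F" and L: "L \<ge> 2 * n + 1" "L \<ge> 0"
  shows "prob {c \<in> space P. \<forall>k<K. translate (real k * L) c \<notin> F} = (1 - prob F) ^ K"
proof (induction K)
  case 0
  then show ?case by (simp add: prob_space)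
next
  case (Suc K)
  let ?G = "\<lambda>K. {c \<in> space P. \<forall>k<K. translate (real k * L) c \<notin> F}"
  have G: "?G K \<in> sets P" for K
  proof -
    have "{c \<in> space P. translate t c \<in> F} \<in> sets P" for t
      using measurable_sets[OF measurable_translate_P F] by (simp add: vimage_def Int_def conj_commute)
    then show ?thesis by (intro sets.sets_Collect_countable_All sets.sets_Collect_imp sets.sets_Collect_neg) auto
  qed
  let ?f = "\<lambda>z. splice_at {-n..n} (fst z) (translate (-L) (snd z))"
  have S: "{z \<in> space (P \<Otimes>\<^sub>M P). ?f z \<in> ?G (Suc K)} = (space P - F) \<times> ?G K"
  proof -
    have key: "?f (a, b) \<in> ?G (Suc K) \<longleftrightarrow> a \<notin> F \<and> b \<in> ?G K"
      if ab: "locally_finite_set a" "locally_finite_set b" for a b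
    proof -
      let ?c = "splice_at {-n..n} a (translate (-L) b)"
      have c: "locally_finite_set ?c" using ab by (intro locally_finite_splice_at locally_finite_translate)
      have "?c \<in> F \<longleftrightarrow> a \<in> F" by (rule determined_onD[OF loc c ab(1)]) simp
      moreover have "translate (real (Suc k) * L) ?c \<in> F \<longleftrightarrow> translate (real k * L) b \<in> F" for k
      proof (rule determined_onD[OF loc])
        show "translate (real (Suc k) * L) ?c \<inter> {-n..n} = translate (real k * L) b \<inter> {-n..n}"
          using translate_splice_at_Int[OF L(1), of "real k * L" a b] L(2) by (simp add: algebra_simps)
      qed (use c ab in \<open>auto intro: locally_finite_translate\<close>)
      ultimately show ?thesis using c ab by (simp add: All_less_Suc2 space_P)
    qed
    show ?thesis
    proof (rule set_eqI)
      fix z :: "real set \<times> real set"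
      show "z \<in> {z \<in> space (P \<Otimes>\<^sub>M P). ?f z \<in> ?G (Suc K)} \<longleftrightarrow> z \<in> (space P - F) \<times> ?G K"
      proof (cases "z \<in> space (P \<Otimes>\<^sub>M P)")
        case True
        then have "locally_finite_set (fst z)" "locally_finite_set (snd z)"
          by (auto simp: space_pair_measure space_P)
        from key[OF this] show ?thesis using True by (simp add: space_pair_measure mem_Times_iff)
      qed (auto simp: space_pair_measure)
    qed
  qed
  have "emeasure P (?G (Suc K)) = emeasure (P \<Otimes>\<^sub>M P) ((space P - F) \<times> ?G K)"
    by (subst emeasure_splice[where A="{-n..n}" and u=L, OF _ G]) (simp, simp only: S)
  also have "\<dots> = emeasure P (space P - F) * emeasure P (?G K)"
    by (rule emeasure_pair_measure_Times[OF sets.compl_sets[OF F] G])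
  finally have "prob (?G (Suc K)) = prob (space P - F) * prob (?G K)"
    unfolding measure_def by (simp only: enn2real_mult)
  then show ?case unfolding prob_compl[OF F] Suc.IH by (simp only: power_Suc)
qed

lemma emeasure_two_windows:
  assumes F: "F \<in> sets P" and loc: "determined_on {-n..n} F" and u: "u \<ge> 2 * n + 1"
    and g: "g \<in> borel_measurable P" and N: "N \<in> sets borel"
    and gloc: "\<And>c c'. c \<in> F \<Longrightarrow> locally_finite_set c' \<Longrightarrow> c \<inter> {-n..n} = c' \<inter> {-n..n} \<Longrightarrow> g c = g c'"
  shows "emeasure P {c \<in> space P. c \<in> F \<and> translate u c \<in> F \<and> u + g (translate u c) - g c \<in> N} =
    emeasure (P \<Otimes>\<^sub>M P) {z \<in> space (P \<Otimes>\<^sub>M P). fst z \<in> F \<and> snd z \<in> F \<and> u + g (snd z) - g (fst z) \<in> N}"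
proof -
  let ?G = "{c \<in> space P. c \<in> F \<and> translate u c \<in> F \<and> u + g (translate u c) - g c \<in> N}"
  have G: "?G \<in> sets P" 
  proof -
    note [measurable] = F g N measurable_translate_P
    show ?thesis by measurable
  qed
  let ?f = "\<lambda>z. splice_at {-n..n} (fst z) (translate (-u) (snd z))"
  have key: "?f (a, b) \<in> ?G \<longleftrightarrow> a \<in> F \<and> b \<in> F \<and> u + g b - g a \<in> N"
    if ab: "locally_finite_set a" "locally_finite_set b" for a b
  proof -
    let ?c = "splice_at {-n..n} a (translate (-u) b)"
    have c: "locally_finite_set ?c" using ab by (intro locally_finite_splice_at locally_finite_translate)
    have tc: "locally_finite_set (translate u ?c)" by (rule locally_finite_translate[OF c])
    have eq1: "a \<inter> {-n..n} = ?c \<inter> {-n..n}" by simp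
    have eq2: "b \<inter> {-n..n} = translate u ?c \<inter> {-n..n}"
      using translate_splice_at_Int[OF u, of 0 a b] by simp
    have "a \<in> F \<longleftrightarrow> ?c \<in> F" "b \<in> F \<longleftrightarrow> translate u ?c \<in> F"
      using determined_onD[OF loc] eq1 eq2 ab c tc by blast+
    moreover have "a \<in> F \<Longrightarrow> g a = g ?c" "b \<in> F \<Longrightarrow> g b = g (translate u ?c)"
      using gloc eq1 eq2 c tc by blast+
    ultimately show ?thesis using c by (auto simp: space_P)
  qed
  have "{z \<in> space (P \<Otimes>\<^sub>M P). ?f z \<in> ?G} =
     {z \<in> space (P \<Otimes>\<^sub>M P). fst z \<in> F \<and> snd z \<in> F \<and> u + g (snd z) - g (fst z) \<in> N}"
    (is "?l = ?r")
  proof (rule set_eqI)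
    fix z :: "real set \<times> real set"
    show "z \<in> ?l \<longleftrightarrow> z \<in> ?r"
    proof (cases "z \<in> space (P \<Otimes>\<^sub>M P)")
      case True
      then have "locally_finite_set (fst z)" "locally_finite_set (snd z)"
        by (auto simp: space_pair_measure space_P)
      from key[OF this] show ?thesis using True by simp
    qed (auto simp: space_pair_measure)
  qed
  then show ?thesis using emeasure_splice[of "{-n..n}" ?G u] G by simp
qed

end

text \<open>For fixed values of \<open>g\<close> the shift \<open>s\<close> avoids the null set for almost every \<open>s\<close>.\<close>

lemma (in prob_space) no_null_set_carries_all_shifts:
  assumes F: "F \<in> events" "prob F > 0" and g: "g \<in> borel_measurable M" and N: "N \<in> null_sets lborel"
    and null: "\<And>s. 0 \<le> s \<Longrightarrow> s \<le> (1::real) \<Longrightarrow> emeasure (M \<Otimes>\<^sub>M M)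
      {z \<in> space (M \<Otimes>\<^sub>M M). fst z \<in> F \<and> snd z \<in> F \<and> L + s + g (snd z) - g (fst z) \<in> UNIV - N} = 0"
  shows False
proof -
  interpret MM: pair_prob_space M M ..
  interpret Q: pair_sigma_finite lborel "M \<Otimes>\<^sub>M M" ..
  have Nb: "N \<in> sets borel" using N by auto
  let ?Q = "\<lambda>s z. s \<in> {0..1} \<longrightarrow> fst z \<in> F \<longrightarrow> snd z \<in> F \<longrightarrow> L + s + g (snd z) - g (fst z) \<in> N"
  note [measurable] = F(1) g Nb
  have meas: "{x \<in> space (lborel \<Otimes>\<^sub>M (M \<Otimes>\<^sub>M M)). ?Q (fst x) (snd x)} \<in> sets (lborel \<Otimes>\<^sub>M (M \<Otimes>\<^sub>M M))"
    by measurable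
  have "AE s in lborel. AE z in M \<Otimes>\<^sub>M M. ?Q s z"
  proof (rule AE_I2)
    fix s :: real
    show "AE z in M \<Otimes>\<^sub>M M. ?Q s z"
    proof (cases "s \<in> {0..1}")
      case True
      let ?B = "{z \<in> space (M \<Otimes>\<^sub>M M). fst z \<in> F \<and> snd z \<in> F \<and> L + s + g (snd z) - g (fst z) \<in> UNIV - N}"
      have "?B \<in> sets (M \<Otimes>\<^sub>M M)" by measurable
      then have "AE z in M \<Otimes>\<^sub>M M. z \<notin> ?B" using null[of s] True by (intro AE_not_in) auto
      with AE_space show ?thesis by eventually_elim auto
    qed auto
  qed
  then have "AE z in M \<Otimes>\<^sub>M M. AE s in lborel. ?Q s z"
    by (subst (asm) Q.AE_commute[OF meas])
  moreover have "emeasure (M \<Otimes>\<^sub>M M) (F \<times> F) \<noteq> 0"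
    using F by (simp add: emeasure_pair_measure_Times emeasure_eq_measure)
  then have "\<not> (AE z in M \<Otimes>\<^sub>M M. z \<notin> F \<times> F)"
    by (subst AE_iff_null_sets[symmetric]) (use F in auto)
  ultimately obtain z where z: "fst z \<in> F" "snd z \<in> F" "AE s in lborel. ?Q s z"
    by (metis (mono_tags, lifting) AE_mp AE_I2 mem_Times_iff)
  define d where "d = L + g (snd z) - g (fst z)"
  have "translate d N \<in> null_sets lborel"
    using N borel_translate[OF Nb, of d] emeasure_lborel_translate[OF Nb, of d] by (simp add: null_sets_def)
  then have "AE s in lborel. s \<notin> translate d N" by (rule AE_not_in)
  with z(3) have "AE s in lborel. s \<notin> {0..1::real}"
    by eventually_elim (use z in \<open>auto simp: mem_translate_iff d_def algebra_simps\<close>)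
  then have "{0..1::real} \<in> null_sets lborel" by (subst AE_iff_null_sets) auto
  then show False by (auto simp: null_sets_def)
qed

subsection \<open>Renewal processes\<close>

lemma strict_mono_surj_int_eq_shift:
  fixes h :: "int \<Rightarrow> int"
  assumes "strict_mono h" "surj h"
  shows "h i = h 0 + i"
proof -
  have step: "h (i + 1) = h i + 1" for i
  proof -
    obtain j where j: "h i + 1 = h j" using assms(2) by (metis surjD)
    then have "i < j" using assms(1) by (metis strict_mono_less zless_add1_eq)
    then have "h (i + 1) \<le> h j" "h i < h (i + 1)"
      using assms(1) by (auto simp: strict_mono_less_eq strict_mono_less)
    with j show ?thesis by simp
  qed
  show ?thesis
  proof (induction i rule: int_induct[where k=0])
    case (step2 i)
    then show ?case using step[of "i - 1"] by simp
  qed (use step in simp_all)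
qed

lemma indexes_points_unique:
  assumes p: "indexes_points p S" and q: "indexes_points q S"
  shows "p = q"
proof -
  have sm: "strict_mono p" "strict_mono q" and rng: "range p = range q"
    using p q by (auto simp: indexes_points_def)
  have "\<exists>j. q i = p j" for i using rng by (metis rangeE rangeI)
  then obtain h where h: "\<And>i. q i = p (h i)" by metis
  have "strict_mono h" using sm h by (metis strict_mono_def strict_mono_less)
  moreover have "surj h"
    unfolding surj_def
  proof
    fix j
    obtain i where "p j = q i" using rng by (metis rangeE rangeI)
    then show "\<exists>i. j = h i" using h sm(1) by (metis strict_mono_eq)
  qed
  ultimately have shift: "h i = h 0 + i" for i by (rule strict_mono_surj_int_eq_shift)
  have "p (h 0) < p 1" "p 0 < p (h 1)"
    using p q h[of 0] h[of 1] unfolding indexes_points_def by linarith+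
  then have "h 0 < 1" "0 < h 1" using sm(1) by (simp_all add: strict_mono_less)
  then have "h 0 = 0" using shift[of 1] by linarith
  then have "h i = i" for i using shift[of i] by simp
  with h show ?thesis by (intro ext) simp
qed

lemma indexes_nth_point:
  assumes "\<exists>p. indexes_points p S" shows "indexes_points (nth_point S) S"
proof -
  have "\<exists>!p. indexes_points p S" using assms indexes_points_unique by blast
  then show ?thesis unfolding nth_point_def by (rule theI')
qed

lemma nth_point_diff_eq_sum_gap:
  "nth_point S (j + int k) - nth_point S j = (\<Sum>i<k. gap (j + int i) S)"
proof (induction k)
  case (Suc k)
  have "nth_point S (j + int (Suc k)) = nth_point S (j + int k) + gap (j + int k) S"
    by (simp add: gap_def algebra_simps)
  then show ?case using Suc by simp
qed simp

lemma indexed_gap_empty: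
  assumes p: "indexes_points p S" and x: "x \<in> S" "p i < x"
  shows "p (i + 1) \<le> x"
proof -
  have sm: "strict_mono p" using p by (simp add: indexes_points_def)
  obtain j where j: "x = p j" using p x by (auto simp: indexes_points_def)
  then have "i < j" using x sm by (simp add: strict_mono_less)
  then show ?thesis using sm j by (simp add: strict_mono_less_eq)
qed

lemma indexes_points_first_positive:
  assumes p: "indexes_points p S" and x: "x \<in> S" "0 < x"
  shows "p 1 \<le> x"
  using indexed_gap_empty[OF p x(1), of 0] p x by (simp add: indexes_points_def)

lemma indexed_void_of_large_gap:
  assumes p: "indexes_points p S" and l: "l > 0" and gap: "p 2 - p 1 \<ge> 4 * l"
  shows "S \<inter> {l..2 * l} = {} \<or> S \<inter> {5 / 2 * l..7 / 2 * l} = {}"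
proof (cases "p 1 > 2 * l")
  case True
  then have "S \<inter> {l..2 * l} = {}" using indexes_points_first_positive[OF p] l by force
  then show ?thesis ..
next
  case False
  have "False" if x: "x \<in> S" "5 / 2 * l \<le> x" "x \<le> 7 / 2 * l" for x
  proof -
    have "p 1 < x" using False x l by linarith
    then have "p 2 \<le> x" using indexed_gap_empty[OF p x(1), of 1] by simp
    moreover have "0 < p 1" using p by (simp add: indexes_points_def)
    ultimately show False using gap x l by linarith
  qed
  then have "S \<inter> {5 / 2 * l..7 / 2 * l} = {}" by auto
  then show ?thesis ..
qed

lemma not_nonsingular_null_set:
  assumes T: "finite_measure T" "sets T = sets borel" and ns: "\<not> nonsingular T"
  obtains N where "N \<in> null_sets lborel" "emeasure T (UNIV - N) = 0"
proof -
  interpret finite_measure T by (rule T)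
  have sp: "space T = UNIV" using sets_eq_imp_space_eq[OF T(2)] by simp
  define V where "V = measure T ` null_sets (lborel :: real measure)"
  have "{} \<in> null_sets (lborel :: real measure)" by simp
  then have V: "V \<noteq> {}" "bdd_above V"
    unfolding V_def by blast
      (rule bdd_aboveI2[where M="measure T (space T)"], rule bounded_measure)
  have "\<exists>Z\<in>null_sets lborel. Sup V - 1 / real (Suc n) < measure T Z" for n
    using less_cSupD[OF V(1), of "Sup V - 1 / real (Suc n)"] by (auto simp: V_def)
  then obtain Z where Z: "\<And>n. Z n \<in> null_sets lborel" "\<And>n. Sup V - 1 / real (Suc n) < measure T (Z n)"
    by metis
  define N where "N = (\<Union>n. Z n)"
  have N: "N \<in> null_sets lborel" unfolding N_def by (rule null_sets_UN) (rule Z)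
  have Nb: "N \<in> sets T" using null_setsD2[OF N] T by simp
  have "Sup V \<le> measure T N"
  proof (rule field_le_epsilon)
    fix e :: real assume "0 < e"
    then obtain n where n: "1 / real (Suc n) < e" using nat_approx_posE by blast
    have "measure T (Z n) \<le> measure T N" using Nb by (intro finite_measure_mono) (auto simp: N_def)
    then show "Sup V \<le> measure T N + e" using Z(2)[of n] n by linarith
  qed
  have ac: "emeasure T (Y - N) = 0" if Y: "Y \<in> null_sets lborel" for Y
  proof -
    have "measure T (Y \<union> N) \<in> V" unfolding V_def by (intro imageI null_sets.Un Y N)
    then have "measure T (Y \<union> N) \<le> Sup V" using V(2) by (rule cSup_upper)
    moreover have "measure T (N \<union> (Y - N)) = measure T N + measure T (Y - N)"
      using null_setsD2[OF Y] null_setsD2[OF N] T by (intro finite_measure_Union) auto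
    moreover have "N \<union> (Y - N) = Y \<union> N" by auto
    ultimately have "measure T (Y - N) \<le> 0" using \<open>Sup V \<le> measure T N\<close> by simp
    then show ?thesis by (simp add: emeasure_eq_measure measure_le_0_iff)
  qed
  define Tac where "Tac = density T (indicator (UNIV - N))"
  define Ts where "Ts = density T (indicator N)"
  have eac: "emeasure Tac A = emeasure T ((UNIV - N) \<inter> A)" and es: "emeasure Ts A = emeasure T (N \<inter> A)"
    if "A \<in> sets borel" for A
    unfolding Tac_def Ts_def using that Nb T sp by (auto intro!: emeasure_restricted)
  have "lebesgue_decomposition T Tac Ts"
    unfolding lebesgue_decomposition_def
  proof (intro conjI ballI)
    fix A :: "real set" assume A: "A \<in> sets borel"
    have "emeasure T (((UNIV - N) \<inter> A) \<union> (N \<inter> A)) = emeasure T ((UNIV - N) \<inter> A) + emeasure T (N \<inter> A)"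
      using A Nb T by (intro plus_emeasure[symmetric]) auto
    moreover have "((UNIV - N) \<inter> A) \<union> (N \<inter> A) = A" by auto
    ultimately show "emeasure T A = emeasure Tac A + emeasure Ts A" using A by (simp add: eac es)
  next
    show "absolutely_continuous lborel Tac"
      unfolding absolutely_continuous_def
    proof
      fix Y :: "real set" assume Y: "Y \<in> null_sets lborel"
      then have "emeasure Tac Y = emeasure T (Y - N)"
        by (subst eac) (auto intro!: arg_cong[of _ _ "emeasure T"])
      then show "Y \<in> null_sets Tac" using ac[OF Y] Y T by (auto simp: null_sets_def Tac_def)
    qed
    have "emeasure Ts (UNIV - N) = 0" using Nb T by (subst es) auto
    then show "\<exists>N\<in>null_sets lborel. emeasure Ts (UNIV - N) = 0" using N by blast
  qed (simp_all add: Tac_def Ts_def T)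
  then have "emeasure Tac UNIV = 0" using ns unfolding nonsingular_def by blast
  then have "emeasure T (UNIV - N) = 0" by (simp add: eac)
  with N show ?thesis by (rule that)
qed

lemma (in prob_space) indep_sets_reindex:
  assumes f: "inj_on f I" and indep: "indep_sets F (f ` I)"
  shows "indep_sets (\<lambda>i. F (f i)) I"
proof (rule indep_setsI)
  show "F (f i) \<subseteq> events" if "i \<in> I" for i using indep that by (auto simp: indep_sets_def)
next
  fix A J assume J: "J \<noteq> {}" "J \<subseteq> I" "finite J" and A: "\<forall>j\<in>J. A j \<in> F (f j)"
  have fJ: "inj_on f J" using f J(2) by (rule inj_on_subset)
  define B where "B y = A (the_inv_into J f y)" for y
  have B: "B (f j) = A j" if "j \<in> J" for j using that fJ by (simp add: B_def the_inv_into_f_f)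
  have "prob (\<Inter>y\<in>f ` J. B y) = (\<Prod>y\<in>f ` J. prob (B y))"
    using J A B by (intro indep_setsD[OF indep]) auto
  then show "prob (\<Inter>j\<in>J. A j) = (\<Prod>j\<in>J. prob (A j))"
    using fJ B by (simp add: prod.reindex)
qed

lemma (in prob_space) indep_vars_reindex:
  assumes "inj_on f I" "indep_vars M' X (f ` I)"
  shows "indep_vars (\<lambda>i. M' (f i)) (\<lambda>i. X (f i)) I"
  using assms(2) indep_sets_reindex[OF assms(1)] unfolding indep_vars_def2 by blast

locale renewal = prob_space M for M :: "'a measure" +
  fixes X :: "'a \<Rightarrow> real set"
  assumes ren: "renewal_process M X"
begin

lemma X_measurable: "X \<in> M \<rightarrow>\<^sub>M point_configs"
  using ren by (simp add: renewal_process_def point_process_def)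

lemma AE_indexed: "AE \<omega> in M. indexes_points (nth_point (X \<omega>)) (X \<omega>)"
  using ren by (auto simp: renewal_process_def intro: indexes_nth_point elim!: eventually_mono)

lemma indep_gaps: "indep_vars (\<lambda>_. borel) (\<lambda>i \<omega>. gap i (X \<omega>)) {1..}"
  using ren by (simp add: renewal_process_def)

lemma gap_measurable: "i \<ge> 1 \<Longrightarrow> (\<lambda>\<omega>. gap i (X \<omega>)) \<in> borel_measurable M"
  using indep_gaps by (simp add: indep_vars_def)

lemma distr_gap: "i \<ge> 1 \<Longrightarrow> distr M borel (\<lambda>\<omega>. gap i (X \<omega>)) = jump_distribution M X"
  using ren unfolding renewal_process_def jump_distribution_def by blast

lemma distr_nth_point_diff:
  assumes "j \<ge> 1" "k \<ge> 1"
  shows "distr M borel (\<lambda>\<omega>. nth_point (X \<omega>) (j + int k) - nth_point (X \<omega>) j) =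
    convolution_power k (jump_distribution M X)"
proof -
  let ?I = "{..<k}" and ?Y = "\<lambda>i \<omega>. gap (j + int i) (X \<omega>)"
  have "indep_vars (\<lambda>_. borel) (\<lambda>i \<omega>. gap i (X \<omega>)) ((\<lambda>i. j + int i) ` ?I)"
    using assms by (intro indep_vars_subset[OF indep_gaps]) auto
  then have "indep_vars (\<lambda>_. borel) ?Y ?I"
    by (rule indep_vars_reindex[rotated]) (simp add: inj_on_def)
  moreover have Ym: "?Y i \<in> borel_measurable M" for i using assms by (intro gap_measurable) simp
  ultimately have "distr M (\<Pi>\<^sub>M i\<in>?I. borel) (\<lambda>\<omega>. \<lambda>i\<in>?I. ?Y i \<omega>) = (\<Pi>\<^sub>M i\<in>?I. distr M borel (?Y i))"
    using assms by (subst (asm) indep_vars_iff_distr_eq_PiM') (auto simp: lessThan_empty_iff)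
  also have "\<dots> = (\<Pi>\<^sub>M i\<in>?I. jump_distribution M X)"
    using assms by (intro PiM_cong) (simp_all add: distr_gap)
  finally have eq: "(\<Pi>\<^sub>M i\<in>?I. jump_distribution M X) = distr M (\<Pi>\<^sub>M i\<in>?I. borel) (\<lambda>\<omega>. \<lambda>i\<in>?I. ?Y i \<omega>)" ..
  have "convolution_power k (jump_distribution M X) = distr M borel ((\<lambda>x. \<Sum>i<k. x i) \<circ> (\<lambda>\<omega>. \<lambda>i\<in>?I. ?Y i \<omega>))"
    unfolding convolution_power_def eq using Ym by (intro distr_distr) (auto intro!: measurable_restrict)
  also have "(\<lambda>x. \<Sum>i<k. x i) \<circ> (\<lambda>\<omega>. \<lambda>i\<in>?I. ?Y i \<omega>) =
      (\<lambda>\<omega>. nth_point (X \<omega>) (j + int k) - nth_point (X \<omega>) j)"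
    by (simp add: comp_def nth_point_diff_eq_sum_gap)
  finally show ?thesis ..
qed

lemma AE_differences_in_null_set:
  assumes "\<not> (\<exists>k\<ge>1. nonsingular (convolution_power k (jump_distribution M X)))"
  obtains N where "N \<in> null_sets lborel"
    "AE \<omega> in M. \<forall>x y. x \<in> X \<omega> \<longrightarrow> y \<in> X \<omega> \<longrightarrow> 0 < x \<longrightarrow> x < y \<longrightarrow> y - x \<in> N"
proof -
  let ?D = "\<lambda>j k \<omega>. nth_point (X \<omega>) (j + int k) - nth_point (X \<omega>) j"
  have Dm: "?D j k \<in> borel_measurable M" if "j \<ge> 1" for j k
    unfolding nth_point_diff_eq_sum_gap using that by (intro borel_measurable_sum gap_measurable) simp
  have "\<exists>N\<in>null_sets lborel. emeasure (convolution_power k (jump_distribution M X)) (UNIV - N) = 0" if "k \<ge> 1" for k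
  proof -
    have "convolution_power k (jump_distribution M X) = distr M borel (?D 1 k)"
      using distr_nth_point_diff[of 1 k] that by simp
    then interpret C: prob_space "convolution_power k (jump_distribution M X)"
      using Dm[of 1 k] by (simp add: prob_space_distr)
    have "\<not> nonsingular (convolution_power k (jump_distribution M X))" using assms that by blast
    from not_nonsingular_null_set[OF C.finite_measure_axioms _ this] show ?thesis
      by (auto simp: convolution_power_def)
  qed
  then obtain N where N: "\<And>k. k \<ge> 1 \<Longrightarrow> N k \<in> null_sets lborel"
    "\<And>k. k \<ge> 1 \<Longrightarrow> emeasure (convolution_power k (jump_distribution M X)) (UNIV - N k) = 0"
    by metis
  define N' where "N' = (\<Union>k. N (Suc k))"
  have "AE \<omega> in M. ?D (int (Suc j)) (Suc k) \<omega> \<in> N'" for j k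
  proof -
    let ?U = "distr M borel (?D (int (Suc j)) (Suc k))"
    have "emeasure ?U (UNIV - N (Suc k)) = 0"
      using distr_nth_point_diff[of "int (Suc j)" "Suc k"] N(2)[of "Suc k"] by simp
    then have "UNIV - N (Suc k) \<in> null_sets ?U" using N(1)[of "Suc k"] by (auto simp: null_sets_def)
    then have "AE x in ?U. x \<notin> UNIV - N (Suc k)" by (rule AE_not_in)
    then have "AE \<omega> in M. ?D (int (Suc j)) (Suc k) \<omega> \<notin> UNIV - N (Suc k)"
      by (rule AE_distrD[rotated]) (rule Dm, simp)
    then show ?thesis by eventually_elim (auto simp: N'_def)
  qed
  then have "AE \<omega> in M. \<forall>j k. ?D (int (Suc j)) (Suc k) \<omega> \<in> N'" by (simp add: AE_all_countable)
  with AE_indexed have "AE \<omega> in M. \<forall>x y. x \<in> X \<omega> \<longrightarrow> y \<in> X \<omega> \<longrightarrow> 0 < x \<longrightarrow> x < y \<longrightarrow> y - x \<in> N'"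
  proof (eventually_elim, intro allI impI)
    fix \<omega> x y
    let ?p = "nth_point (X \<omega>)"
    assume p: "indexes_points ?p (X \<omega>)" and D: "\<forall>j k. ?D (int (Suc j)) (Suc k) \<omega> \<in> N'"
      and xy: "x \<in> X \<omega>" "y \<in> X \<omega>" "0 < x" "x < y"
    have sm: "strict_mono ?p" and "?p 0 \<le> 0" using p by (auto simp: indexes_points_def)
    have "x \<in> range ?p" "y \<in> range ?p" using p xy by (simp_all add: indexes_points_def)
    then obtain i j where ij: "x = ?p i" "y = ?p j" by blast
    then have "?p 0 < ?p i" "?p i < ?p j" using xy \<open>?p 0 \<le> 0\<close> by auto
    then have "0 < i" "i < j" using sm by (simp_all add: strict_mono_less)
    then have "int (Suc (nat (i - 1))) = i" "int (Suc (nat (i - 1))) + int (Suc (nat (j - i - 1))) = j" by auto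
    then show "y - x \<in> N'" using D ij by metis
  qed
  moreover have "N' \<in> null_sets lborel" unfolding N'_def using N(1) by (intro null_sets_UN) simp
  ultimately show ?thesis using that by blast
qed

lemma exponential_tails_if_voids_decay:
  fixes p L :: real
  assumes p: "0 < p" "p \<le> 1" and L: "0 < L"
    and void: "\<And>a b K. b - a \<ge> real K * L \<Longrightarrow> prob {\<omega> \<in> space M. X \<omega> \<inter> {a..b} = {}} \<le> (1 - p) ^ K"
  shows "exponential_tails (jump_distribution M X)"
proof -
  define c where "c = p / (4 * L)"
  have "measure (jump_distribution M X) {t..} \<le> 2 * exp p * exp (- c * t)" if t: "t \<ge> 0" for t
  proof (cases "t = 0")
    case True
    have "prob_space (jump_distribution M X)"
      unfolding jump_distribution_def by (intro prob_space_distr gap_measurable) simp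
    then have "measure (jump_distribution M X) {t..} \<le> 1" by (rule prob_space.prob_le_1)
    also have "1 \<le> 2 * exp p" using p one_le_exp_iff[of p] by linarith
    finally show ?thesis using True by simp
  next
    case False
    define l where "l = t / 4"
    have l: "l > 0" using t False by (simp add: l_def)
    define K where "K = nat \<lfloor>l / L\<rfloor>"
    have K: "real K \<le> l / L" "l / L - 1 \<le> real K"
      using l L unfolding K_def by (simp_all add: of_nat_nat)
    have KL: "real K * L \<le> l" using K(1) L by (simp add: field_simps)
    have decay: "(1 - p) ^ K \<le> exp p * exp (- c * t)"
    proof -
      have "(1 - p) ^ K \<le> exp (- p) ^ K"
        using p exp_ge_add_one_self[of "-p"] by (intro power_mono) auto
      also have "\<dots> = exp (- (p * real K))" by (simp add: exp_of_nat_mult[symmetric] mult.commute)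
      also have "\<dots> \<le> exp (p - p * (l / L))"
        using mult_left_mono[OF K(2), of p] p by (simp add: algebra_simps)
      also have "p * (l / L) = c * t" by (simp add: c_def l_def)
      finally show ?thesis by (simp add: exp_diff exp_minus field_simps)
    qed
    let ?V = "\<lambda>a b. {\<omega> \<in> space M. X \<omega> \<inter> {a..b} = {}}"
    have V: "?V a b \<in> events" for a b by (intro Int_empty_measurable X_measurable) auto
    have "measure (jump_distribution M X) {t..} = prob {\<omega> \<in> space M. gap 1 (X \<omega>) \<ge> t}"
      unfolding jump_distribution_def using gap_measurable[of 1]
      by (subst measure_distr) (auto intro!: arg_cong[of _ _ prob])
    also have "\<dots> \<le> prob (?V l (2 * l) \<union> ?V (5 / 2 * l) (7 / 2 * l))"
    proof (rule finite_measure_mono_AE)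
      show "AE \<omega> in M. \<omega> \<in> {\<omega> \<in> space M. gap 1 (X \<omega>) \<ge> t} \<longrightarrow>
          \<omega> \<in> ?V l (2 * l) \<union> ?V (5 / 2 * l) (7 / 2 * l)"
        using AE_indexed
      proof (eventually_elim, intro impI)
        fix \<omega> assume ind: "indexes_points (nth_point (X \<omega>)) (X \<omega>)"
          and \<omega>: "\<omega> \<in> {\<omega> \<in> space M. gap 1 (X \<omega>) \<ge> t}"
        have "nth_point (X \<omega>) 2 - nth_point (X \<omega>) 1 \<ge> 4 * l" using \<omega> by (simp add: gap_def l_def)
        from indexed_void_of_large_gap[OF ind l this] \<omega>
        show "\<omega> \<in> ?V l (2 * l) \<union> ?V (5 / 2 * l) (7 / 2 * l)" by auto
      qed
    qed (use V in auto)
    also have "\<dots> \<le> prob (?V l (2 * l)) + prob (?V (5 / 2 * l) (7 / 2 * l))"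
      by (rule measure_Un_le[OF V V])
    also have "\<dots> \<le> (1 - p) ^ K + (1 - p) ^ K"
      using KL by (intro add_mono void) auto
    finally show ?thesis using decay by linarith
  qed
  moreover have "c > 0" using p L by (simp add: c_def)
  ultimately show ?thesis unfolding exponential_tails_def
    by (intro exI[of _ "2 * exp p"] exI[of _ c] conjI) auto
qed

end

subsection \<open>Finitary factors\<close>

definition first_in_unit_window :: "real set \<Rightarrow> real" where
  "first_in_unit_window S = (if S \<inter> {-1..1} = {} then 0 else Min (S \<inter> {-1..1}))"

lemma first_in_unit_window_mem:
  assumes "locally_finite_set S" "S \<inter> {-1..1} \<noteq> {}"
  shows "first_in_unit_window S \<in> S \<inter> {-1..1}"
  unfolding first_in_unit_window_def using assms
  by (simp del: Int_iff Int_atLeastAtMost) (intro Min_in, auto simp: locally_finite_set_def)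

lemma first_in_unit_window_cong:
  "S \<inter> {-1..1} = S' \<inter> {-1..1} \<Longrightarrow> first_in_unit_window S = first_in_unit_window S'"
  by (simp add: first_in_unit_window_def)

lemma first_in_unit_window_measurable:
  "first_in_unit_window \<in> borel_measurable point_configs"
  unfolding borel_measurable_iff_le
proof
  fix a :: real
  have meas: "{S \<in> space point_configs. S \<inter> B = {}} \<in> sets point_configs" if "B \<in> sets borel" "bounded B" for B
    using that by (intro Int_empty_measurable) auto
  have "first_in_unit_window S \<le> a \<longleftrightarrow>
      S \<inter> {-1..1} = {} \<and> 0 \<le> a \<or> \<not> S \<inter> ({-1..1} \<inter> {..a}) = {}" if "locally_finite_set S" for S
  proof (cases "S \<inter> {-1..1} = {}")
    case False
    have "finite (S \<inter> {-1..1})" using that by (simp add: locally_finite_set_def)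
    then have "Min (S \<inter> {-1..1}) \<le> a \<longleftrightarrow> (\<exists>x\<in>S \<inter> {-1..1}. x \<le> a)"
      using False by (rule Min_le_iff)
    then show ?thesis using False unfolding first_in_unit_window_def by auto
  qed (auto simp: first_in_unit_window_def)
  then have "{S \<in> space point_configs. first_in_unit_window S \<le> a} =
      {S \<in> space point_configs. S \<inter> {-1..1} = {} \<and> 0 \<le> a \<or> \<not> S \<inter> ({-1..1} \<inter> {..a}) = {}}"
    by (intro Collect_cong conj_cong refl) (simp add: space_point_configs)
  also have "\<dots> \<in> sets point_configs"
    by (intro sets.sets_Collect_disj sets.sets_Collect_conj sets.sets_Collect_neg meas) auto
  finally show "{S \<in> space point_configs. first_in_unit_window S \<le> a} \<in> sets point_configs" .
qed

lemma poisson_law_law: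
  assumes "poisson_process r N \<Lambda>"
  shows "poisson_law (law N \<Lambda>) r"
proof -
  have m: "\<Lambda> \<in> N \<rightarrow>\<^sub>M point_configs" and pN: "prob_space N"
    using assms by (auto simp: poisson_process_def point_process_def)
  have pr: "measure N {\<omega> \<in> space N. card (\<Lambda> \<omega> \<inter> B) = n} =
      (r * measure lborel B) ^ n / fact n * exp (- (r * measure lborel B))"
    if "B \<in> sets borel" "bounded B" for B n
    using assms that unfolding poisson_process_def by blast
  interpret N: prob_space N by (rule pN)
  interpret P: prob_space "law N \<Lambda>" unfolding law_def by (rule N.prob_space_distr[OF m])
  show ?thesis
  proof
    show "sets (law N \<Lambda>) = sets point_configs" by (simp add: law_def)
    fix B :: "real set" assume B: "B \<in> sets borel" "bounded B"
    have "\<Lambda> -` void_event B \<inter> space N = {\<omega> \<in> space N. card (\<Lambda> \<omega> \<inter> B) = 0}"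
      using finite_Int_bounded[OF locally_finite_space[OF m] B(2)] locally_finite_space[OF m]
      by (auto simp: void_event_def)
    then show "P.prob (void_event B) = exp (- (r * measure lborel B))"
      using pr[OF B, of 0] void_event_sets[OF B] m by (simp add: law_def measure_distr)
  qed
qed

locale renewal_factor = renewal M X + P: poisson_law P r
  for M :: "'a measure" and X :: "'a \<Rightarrow> real set" and P :: "real set measure" and r :: real +
  fixes \<phi> :: "real set \<Rightarrow> real set" and w :: "real set \<Rightarrow> enat"
  assumes statX: "stationary M X"
    and phi: "\<phi> \<in> point_configs \<rightarrow>\<^sub>M point_configs"
    and law_phi: "distr P point_configs \<phi> = law M X"
    and equivariant: "AE c in P. \<forall>t. \<phi> (translate t c) = translate t (\<phi> c)"
    and window: "coding_window \<phi> w" and window_finite: "AE c in P. w c < \<infinity>"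
begin

lemma phi_P: "\<phi> \<in> P \<rightarrow>\<^sub>M point_configs"
  using phi by (simp add: P.measurable_P)

lemma emeasure_phi_eq:
  assumes G: "G \<in> sets point_configs"
  shows "emeasure P {c \<in> space P. \<phi> c \<in> G} = emeasure M {\<omega> \<in> space M. translate t (X \<omega>) \<in> G}"
proof -
  have "emeasure P {c \<in> space P. \<phi> c \<in> G} = emeasure (distr P point_configs \<phi>) G"
    using phi_P G by (subst emeasure_distr) (auto intro!: arg_cong[of _ _ "emeasure P"])
  also have "\<dots> = emeasure (distr M point_configs (\<lambda>\<omega>. translate t (X \<omega>))) G"
    using statX law_phi by (simp add: stationary_def law_def)
  also have "\<dots> = emeasure M {\<omega> \<in> space M. translate t (X \<omega>) \<in> G}"
    using measurable_translate[OF X_measurable, of t] G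
    by (subst emeasure_distr) (auto intro!: arg_cong[of _ _ "emeasure M"])
  finally show ?thesis .
qed

lemma phi_hits_unit_window: "P.prob {c \<in> space P. \<phi> c \<inter> {-1..1} \<noteq> {}} > 0"
proof (rule ccontr)
  assume "\<not> ?thesis"
  then have zero: "emeasure P {c \<in> space P. \<phi> c \<inter> {-1..1} \<noteq> {}} = 0"
    by (simp add: P.emeasure_eq_measure not_less measure_le_0_iff)
  define G where "G = {S \<in> space point_configs. \<not> S \<inter> {-1..1} = {}}"
  have G: "G \<in> sets point_configs"
    unfolding G_def by (intro sets.sets_Collect_neg Int_empty_measurable) auto
  have "{c \<in> space P. \<phi> c \<in> G} = {c \<in> space P. \<phi> c \<inter> {-1..1} \<noteq> {}}"
    using measurable_space[OF phi_P] by (auto simp: G_def)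
  then have "emeasure M {\<omega> \<in> space M. translate t (X \<omega>) \<in> G} = 0" for t
    using emeasure_phi_eq[OF G, of t] zero by simp
  moreover have "{\<omega> \<in> space M. translate t (X \<omega>) \<in> G} \<in> events" for t
    using measurable_sets[OF measurable_translate[OF X_measurable] G, of t]
    by (simp add: vimage_def Int_def conj_commute)
  ultimately have "AE \<omega> in M. \<forall>i::int. \<omega> \<notin> {\<omega> \<in> space M. translate (of_int i) (X \<omega>) \<in> G}"
    unfolding AE_all_countable by (intro allI AE_not_in) (simp add: null_sets_def)
  with AE_indexed AE_space have "AE \<omega> in M. False"
  proof eventually_elim
    case (elim \<omega>)
    define x where "x = nth_point (X \<omega>) 0"
    have "x \<in> X \<omega>" using elim(1) by (auto simp: x_def indexes_points_def)
    then have "x - of_int \<lfloor>x\<rfloor> \<in> translate (of_int \<lfloor>x\<rfloor>) (X \<omega>) \<inter> {-1..1}"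
      by (simp add: mem_translate_iff) linarith
    moreover have "translate (of_int \<lfloor>x\<rfloor>) (X \<omega>) \<in> space point_configs"
      using measurable_space[OF measurable_translate[OF X_measurable]] elim(2) by blast
    ultimately show False using elim(2,3) unfolding G_def by blast
  qed
  then show False by simp
qed

lemma jump_distribution_properties:
  "exponential_tails (jump_distribution M X) \<and>
    (\<exists>k\<ge>1. nonsingular (convolution_power k (jump_distribution M X)))"
proof -
  obtain n :: nat and F where F: "F \<in> sets P" "P.prob F > 0"
    and loc: "determined_on {-real n..real n} F"
    and hit: "\<And>c. c \<in> F \<Longrightarrow> \<phi> c \<inter> {-1..1} \<noteq> {}"
    and coded: "\<And>c c'. c \<in> F \<Longrightarrow> locally_finite_set c' \<Longrightarrow>
      c \<inter> {-real n..real n} = c' \<inter> {-real n..real n} \<Longrightarrow> \<phi> c \<inter> {-1..1} = \<phi> c' \<inter> {-1..1}"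
    using P.obtains_local_event[OF window window_finite phi phi_hits_unit_window] by metis
  show ?thesis
  proof
    define L where "L = 2 * real n + 1"
    have L: "L \<ge> 1" by (simp add: L_def)
    show "exponential_tails (jump_distribution M X)"
    proof (rule exponential_tails_if_voids_decay)
      show "0 < P.prob F" "P.prob F \<le> 1" using F by simp_all
      show "0 < L + 2" using L by simp
      fix a b :: real and K :: nat assume ab: "b - a \<ge> real K * (L + 2)"
      let ?B = "{-1..b - a - 1}"
      have B: "void_event ?B \<in> sets point_configs" by (intro void_event_sets) auto
      have "{\<omega> \<in> space M. X \<omega> \<inter> {a..b} = {}} = {\<omega> \<in> space M. translate (a + 1) (X \<omega>) \<in> void_event ?B}"
      proof -
        have "translate (- (a + 1)) ?B = {a..b}" by (auto simp: mem_translate_iff)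
        then show ?thesis
          using locally_finite_translate[OF locally_finite_space[OF X_measurable]]
          by (auto simp: void_event_def translate_Int_empty_iff)
      qed
      then have "prob {\<omega> \<in> space M. X \<omega> \<inter> {a..b} = {}} = P.prob {c \<in> space P. \<phi> c \<in> void_event ?B}"
        using emeasure_phi_eq[OF B, of "a + 1"] by (simp add: measure_def)
      also have "\<dots> \<le> P.prob {c \<in> space P. \<forall>k<K. translate (real k * L) c \<notin> F}"
      proof (rule P.finite_measure_mono_AE)
        show "AE c in P. c \<in> {c \<in> space P. \<phi> c \<in> void_event ?B} \<longrightarrow>
            c \<in> {c \<in> space P. \<forall>k<K. translate (real k * L) c \<notin> F}"
          using equivariant
        proof (eventually_elim, safe)
          fix c k assume eq: "\<forall>t. \<phi> (translate t c) = translate t (\<phi> c)"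
            and void: "\<phi> c \<in> void_event ?B" and k: "k < K" and inF: "translate (real k * L) c \<in> F"
          obtain x where x: "x + real k * L \<in> \<phi> c" "-1 \<le> x" "x \<le> 1"
            using hit[OF inF] eq by (auto simp: mem_translate_iff)
          have "real k + 1 \<le> real K" using k by linarith
          then have "(real k + 1) * (L + 2) \<le> real K * (L + 2)" using L by (intro mult_right_mono) auto
          then have "real k * L + L + 2 \<le> real K * (L + 2)" by (simp add: algebra_simps)
          moreover have "0 \<le> real k * L" using L by simp
          ultimately have "-1 \<le> x + real k * L" "x + real k * L \<le> b - a - 1"
            using x ab L by linarith+
          with void x(1) show False by (auto simp: void_event_def)
        qed
        have "{c \<in> space P. translate t c \<in> F} \<in> sets P" for t
          using measurable_sets[OF P.measurable_translate_P F(1)] by (simp add: vimage_def Int_def conj_commute)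
        then show "{c \<in> space P. \<forall>k<K. translate (real k * L) c \<notin> F} \<in> sets P"
          by (intro sets.sets_Collect_countable_All sets.sets_Collect_imp sets.sets_Collect_neg) auto
      qed
      also have "\<dots> = (1 - P.prob F) ^ K"
        by (rule P.prob_no_translate_in[OF F(1) loc]) (simp_all add: L_def)
      finally show "prob {\<omega> \<in> space M. X \<omega> \<inter> {a..b} = {}} \<le> (1 - P.prob F) ^ K" .
    qed
  next
    let ?h = first_in_unit_window
    define g where "g c = ?h (\<phi> c)" for c
    have g: "g \<in> borel_measurable P"
      unfolding g_def using measurable_compose[OF phi_P first_in_unit_window_measurable] .
    have gloc: "g c = g c'" if "c \<in> F" "locally_finite_set c'" "c \<inter> {-real n..real n} = c' \<inter> {-real n..real n}" for c c'
      unfolding g_def by (rule first_in_unit_window_cong[OF coded[OF that]])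
    show "\<exists>k\<ge>1. nonsingular (convolution_power k (jump_distribution M X))"
    proof (rule ccontr)
      assume "\<not> ?thesis"
      then obtain N where N: "N \<in> null_sets lborel" and
        diff: "AE \<omega> in M. \<forall>x y. x \<in> X \<omega> \<longrightarrow> y \<in> X \<omega> \<longrightarrow> 0 < x \<longrightarrow> x < y \<longrightarrow> y - x \<in> N"
        by (rule AE_differences_in_null_set)
      have Nb: "N \<in> sets borel" using null_setsD2[OF N] by simp
      show False
      proof (rule P.no_null_set_carries_all_shifts[OF F g N])
        fix s :: real assume s: "0 \<le> s" "s \<le> 1"
        define u where "u = 2 * real n + 3 + s"
        have u: "u \<ge> 2 * real n + 1" "u \<ge> 3" using s by (simp_all add: u_def)
        define G where "G = {S \<in> space point_configs. \<not> S \<inter> {-1..1} = {} \<and>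
          \<not> translate u S \<inter> {-1..1} = {} \<and> u + ?h (translate u S) - ?h S \<in> UNIV - N}"
        have hu: "(\<lambda>S. u + ?h (translate u S) - ?h S) \<in> borel_measurable point_configs"
          using first_in_unit_window_measurable
            measurable_compose[OF measurable_translate[OF measurable_ident] first_in_unit_window_measurable]
          by simp
        have G: "G \<in> sets point_configs"
        proof -
          have "{S \<in> space point_configs. u + ?h (translate u S) - ?h S \<in> UNIV - N} \<in> sets point_configs"
            using measurable_sets[OF hu, of "UNIV - N"] Nb by (simp add: vimage_def Int_def conj_commute)
          then show ?thesis unfolding G_def
            by (intro sets.sets_Collect_conj sets.sets_Collect_neg Int_empty_measurable measurable_translate) auto
        qed
        have "AE \<omega> in M. \<omega> \<notin> {\<omega> \<in> space M. translate 2 (X \<omega>) \<in> G}"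
          using diff
        proof (eventually_elim, safe)
          fix \<omega> assume d: "\<forall>x y. x \<in> X \<omega> \<longrightarrow> y \<in> X \<omega> \<longrightarrow> 0 < x \<longrightarrow> x < y \<longrightarrow> y - x \<in> N"
            and inG: "translate 2 (X \<omega>) \<in> G"
          let ?S = "translate 2 (X \<omega>)"
          have lf: "locally_finite_set ?S" using inG by (simp add: G_def space_point_configs)
          have ne: "?S \<inter> {-1..1} \<noteq> {}" "translate u ?S \<inter> {-1..1} \<noteq> {}" using inG by (simp_all add: G_def)
          have "?h ?S \<in> ?S \<inter> {-1..1}" "?h (translate u ?S) \<in> translate u ?S \<inter> {-1..1}"
            by (rule first_in_unit_window_mem[OF lf ne(1)])
              (rule first_in_unit_window_mem[OF locally_finite_translate[OF lf] ne(2)])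
          then have "?h ?S + 2 \<in> X \<omega>" "?h (translate u ?S) + u + 2 \<in> X \<omega>"
              "0 < ?h ?S + 2" "?h ?S + 2 < ?h (translate u ?S) + u + 2"
            using u by (auto simp: mem_translate_iff)
          then have "?h (translate u ?S) + u + 2 - (?h ?S + 2) \<in> N" using d by blast
          then have "u + ?h (translate u ?S) - ?h ?S \<in> N" by (simp add: algebra_simps)
          with inG show False by (simp add: G_def)
        qed
        then have "emeasure M {\<omega> \<in> space M. translate 2 (X \<omega>) \<in> G} = 0"
          using measurable_sets[OF measurable_translate[OF X_measurable] G, of 2]
          by (subst (asm) AE_iff_null_sets[symmetric]) (auto simp: vimage_def Int_def conj_commute null_sets_def)
        then have zero: "emeasure P {c \<in> space P. \<phi> c \<in> G} = 0" using emeasure_phi_eq[OF G, of 2] by simp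
        have "emeasure P {c \<in> space P. c \<in> F \<and> translate u c \<in> F \<and> u + g (translate u c) - g c \<in> UNIV - N} \<le>
            emeasure P {c \<in> space P. \<phi> c \<in> G}"
        proof (rule emeasure_mono_AE)
          show "AE c in P. c \<in> {c \<in> space P. c \<in> F \<and> translate u c \<in> F \<and> u + g (translate u c) - g c \<in> UNIV - N} \<longrightarrow>
              c \<in> {c \<in> space P. \<phi> c \<in> G}"
            using equivariant
          proof (eventually_elim, intro impI)
            fix c assume eq: "\<forall>t. \<phi> (translate t c) = translate t (\<phi> c)"
              and c: "c \<in> {c \<in> space P. c \<in> F \<and> translate u c \<in> F \<and> u + g (translate u c) - g c \<in> UNIV - N}"
            have "\<phi> c \<in> space point_configs" using measurable_space[OF phi_P] c by blast
            moreover have "\<phi> c \<inter> {-1..1} \<noteq> {}" "translate u (\<phi> c) \<inter> {-1..1} \<noteq> {}"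
              using hit[of c] hit[of "translate u c"] c eq by auto
            ultimately show "c \<in> {c \<in> space P. \<phi> c \<in> G}" using c eq by (simp add: G_def g_def)
          qed
          show "{c \<in> space P. \<phi> c \<in> G} \<in> sets P"
            using measurable_sets[OF phi_P G] by (simp add: vimage_def Int_def conj_commute)
        qed
        then have "emeasure P {c \<in> space P. c \<in> F \<and> translate u c \<in> F \<and> u + g (translate u c) - g c \<in> UNIV - N} = 0"
          using zero by simp
        moreover have "UNIV - N \<in> sets borel" using Nb by auto
        note P.emeasure_two_windows[OF F(1) loc u(1) g this gloc]
        ultimately show "emeasure (P \<Otimes>\<^sub>M P) {z \<in> space (P \<Otimes>\<^sub>M P). fst z \<in> F \<and> snd z \<in> F \<and>
            2 * real n + 3 + s + g (snd z) - g (fst z) \<in> UNIV - N} = 0"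
          unfolding u_def by (simp only:)
      qed
    qed
  qed
qed

end

theorem proposition23:
  fixes M :: "'a measure" and X :: "'a \<Rightarrow> real set"
    and N :: "'b measure" and \<Lambda> :: "'b \<Rightarrow> real set" and r :: real
  assumes "stationary M X"
    and "renewal_process M X"
    and "poisson_process r N \<Lambda>"
    and "finitary_factor N \<Lambda> M X"
  shows "exponential_tails (jump_distribution M X) \<and>
    (\<exists>k\<ge>1. nonsingular (convolution_power k (jump_distribution M X)))"
proof -
  obtain \<phi> w where factor: "is_factor N \<Lambda> M X \<phi>" and w: "coding_window \<phi> w"
    and fin: "AE \<omega> in N. w (\<Lambda> \<omega>) < \<infinity>"
    using assms(4) unfolding finitary_factor_def by blast
  have \<Lambda>: "\<Lambda> \<in> N \<rightarrow>\<^sub>M point_configs"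
    using assms(3) by (simp add: poisson_process_def point_process_def)
  have \<phi>: "\<phi> \<in> point_configs \<rightarrow>\<^sub>M point_configs" using factor by (simp add: is_factor_def)
  have wm: "w \<in> point_configs \<rightarrow>\<^sub>M count_space UNIV" using w by (simp add: coding_window_def)
  have "distr (law N \<Lambda>) point_configs \<phi> = law M X"
    using factor \<Lambda> \<phi> by (simp add: is_factor_def law_def distr_distr comp_def)
  moreover have "AE c in law N \<Lambda>. w c < \<infinity>"
  proof -
    have "{c \<in> space point_configs. w c < \<infinity>} \<in> sets point_configs"
      using measurable_sets[OF wm, of "{..<\<infinity>}"] by (simp add: vimage_def Int_def conj_commute)
    then show ?thesis unfolding law_def using fin \<Lambda> by (subst AE_distr_iff) auto
  qed
  moreover have "prob_space M" using assms(2) by (simp add: renewal_process_def point_process_def)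
  ultimately have "renewal_factor M X (law N \<Lambda>) r \<phi> w"
    using assms factor \<phi> w poisson_law_law[OF assms(3)]
    by (simp add: renewal_factor_def renewal_def renewal_axioms_def renewal_factor_axioms_def is_factor_def)
  then show ?thesis by (rule renewal_factor.jump_distribution_properties)
qed

end
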